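(* Let $\{x_k\}_{k\ge 0}$ be the sequence of iterates of the stochastic switching proximal subgradient method (primal method) with stepsizes $\alpha_k>0$, and let $\{y_k\}_{k\ge 0}$ be the sequence of iterates of the stochastic Lagrangian proximal dual averaging method (dual method) with dual weights $\lambda_k>0$, regularization parameters $\beta_k\ge 0$ and parameter $\mu\ge 0$, both methods using the same oracles, the same selection rule $s(\cdot)$ and the same samples $\xi_k$. If $x_0=y_0$, $\beta_k=\bar\beta\ge 0$ is constant in $k$ with $\mu+\bar\beta>0$, and $$\alpha_k=\frac{\lambda_k}{\mu\sum_{i=0}^k\lambda_i+\bar\beta}\qquad\text{for all }k\ge 0,$$ then the two methods are equivalent, that is, $x_k=y_k$ for all $k\ge 0$.
   Context: **Problem.** Let $\mathcal{E}$ be a finite-dimensional Euclidean space, $m\ge 0$ an integer, $f_0,f_1,\dots,f_m\colon\mathcal{E}\to\mathbb{R}$ convex functions, and $r\colon\mathcal{E}\to\mathbb{R}\cup\{\infty\}$ a proper closed convex function. The problem is to minimize $f_0(x)+r(x)$ subject to $f_s(x)\le 0$ for $s=1,\dots,m$. A point $x\in\mathcal{E}$ is called feasible if $f_s(x)\le 0$ for all $s=1,\dots,m$ (regardless of the value of $r(x)$). The selection rule is a map $s(\cdot)$ with $s(x)=0$ if $x$ is feasible, and otherwise $s(x)\in\{1,\dots,m\}$ is some fixed choice of violated constraint, $f_{s(x)}(x)>0$. Stochastic subgradient oracles $g_s(x;\xi)\in\mathcal{E}$ satisfy $\mathbb{E}_\xi\, g_s(x;\xi)\in\partial f_s(x)$.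 The samples $\xi_0,\xi_1,\dots$ are i.i.d. The proximal operator is $\mathrm{prox}_{\alpha,r}(z)=\operatorname{argmin}_x\{r(x)+\frac{1}{2\alpha}\|x-z\|_2^2\}$. **Primal method** (stochastic switching proximal subgradient method): $$x_{k+1}=\begin{cases}\mathrm{prox}_{\alpha_k,r}\big(x_k-\alpha_k g_0(x_k;\xi_k)\big)&\text{if }x_k\text{ is feasible},\\ x_k-\alpha_k g_{s(x_k)}(x_k;\xi_k)&\text{otherwise.}\end{cases}$$ **Dual method** (stochastic Lagrangian proximal dual averaging). At iteration $k$, with empty sums equal to zero, set $$F_s^{(k-1)}(y)=\sum_{i<k:\,s(y_i)=s}\lambda_i\Big(f_{s(y_i)}(y_i)+\langle g_{s(y_i)}(y_i;\xi_i),y-y_i\rangle+\tfrac{\mu}{2}\|y-y_i\|_2^2\Big),\quad s=0,\dots,m,$$ $$R^{(k-1)}(y)=\sum_{i<k:\,s(y_i)=0}\lambda_i\big(r(y_{i+1})+\langle n_{i+1},y-y_{i+1}\rangle\big),\qquad M^{(k-1)}(y)=\sum_{s=0}^mF_s^{(k-1)}(y)+R^{(k-1)}(y),$$ where, whenever $s(y_i)=0$, $$n_{i+1}=-\frac{1}{\lambda_i}\Big(\nabla M^{(i-1)}(y_{i+1})+\lambda_i\big(g_0(y_i;\xi_i)+\mu(y_{i+1}-y_i)\big)+\beta_i(y_{i+1}-y_0)\Big)\in\partial r(y_{i+1}).$$ Let $$U^{(k)}(y)=\begin{cases}\lambda_k\big(f_0(y_k)+\langle g_0(y_k;\xi_k),y-y_k\rangle+\frac{\mu}{2}\|y-y_k\|_2^2+r(y)\big)&\text{if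 }y_k\text{ is feasible},\\ \lambda_k\big(f_{s(y_k)}(y_k)+\langle g_{s(y_k)}(y_k;\xi_k),y-y_k\rangle+\frac{\mu}{2}\|y-y_k\|_2^2\big)&\text{otherwise,}\end{cases}$$ and $$y_{k+1}=\operatorname{argmin}_y\Big\{M^{(k-1)}(y)+U^{(k)}(y)+\frac{\beta_k}{2}\|y-y_0\|_2^2\Big\}.$$ *)

theory Defs
  imports "HOL-Probability.Probability"
begin

definition epi :: "('a \<Rightarrow> ereal) \<Rightarrow> ('a \<times> real) set" where
  "epi h = {(x, t). h x \<le> ereal t}"

definition proper_closed_convex :: "('a::euclidean_space \<Rightarrow> ereal) \<Rightarrow> bool" where
  "proper_closed_convex h \<longleftrightarrow>
     (\<forall>x. h x \<noteq> -\<infinity>) \<and> (\<exists>x. h x \<noteq> \<infinity>) \<and> closed (epi h) \<and> convex (epi h)"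

definition subdifferential :: "('a::real_inner \<Rightarrow> real) \<Rightarrow> 'a \<Rightarrow> 'a set" where
  "subdifferential h x = {v. \<forall>y. h x + inner v (y - x) \<le> h y}"

definition grad :: "('a::real_inner \<Rightarrow> real) \<Rightarrow> 'a \<Rightarrow> 'a" where
  "grad h x = (THE v. GDERIV h x :> v)"

(* The set of global minimizers. The methods below only require the next iterate to be a member;
   that the minimizer is unique is not built in. *)
definition argmin_set :: "('a \<Rightarrow> ereal) \<Rightarrow> 'a set" where
  "argmin_set h = {x. is_arg_min h (\<lambda>_. True) x}"

definition prox :: "real \<Rightarrow> ('a::euclidean_space \<Rightarrow> ereal) \<Rightarrow> 'a \<Rightarrow> 'a set" where
  "prox a r z = argmin_set (\<lambda>x. r x + ereal (1 / (2 * a) * (norm (x - z))\<^sup>2))"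

(* The objective is f 0 + r; the constraint functions are f 1, ..., f m. *)
definition feasible :: "nat \<Rightarrow> (nat \<Rightarrow> 'a \<Rightarrow> real) \<Rightarrow> 'a \<Rightarrow> bool" where
  "feasible m f x \<longleftrightarrow> (\<forall>s\<in>{1..m}. f s x \<le> 0)"

definition selection_rule :: "nat \<Rightarrow> (nat \<Rightarrow> 'a \<Rightarrow> real) \<Rightarrow> ('a \<Rightarrow> nat) \<Rightarrow> bool" where
  "selection_rule m f sel \<longleftrightarrow>
     (\<forall>x. if feasible m f x then sel x = 0 else sel x \<in> {1..m} \<and> f (sel x) x > 0)"

(* D is the common law of the samples. *)
definition unbiased_oracle ::
  "nat \<Rightarrow> (nat \<Rightarrow> 'a::euclidean_space \<Rightarrow> real) \<Rightarrow> 'b measure \<Rightarrow> (nat \<Rightarrow> 'a \<Rightarrow> 'b \<Rightarrow> 'a) \<Rightarrow> bool" where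
  "unbiased_oracle m f D g \<longleftrightarrow>
     (\<forall>s\<le>m. \<forall>x. integrable D (g s x) \<and> integral\<^sup>L D (g s x) \<in> subdifferential (f s) x)"

definition iid_samples :: "'w measure \<Rightarrow> 'b measure \<Rightarrow> (nat \<Rightarrow> 'w \<Rightarrow> 'b) \<Rightarrow> bool" where
  "iid_samples P D \<xi> \<longleftrightarrow>
     prob_space.indep_vars P (\<lambda>_. D) \<xi> UNIV \<and> (\<forall>k. distr P D (\<xi> k) = D)"

(* In the following, \<xi> k is the realized value of the k-th sample and x, y, n are
   sample paths. *)

definition primal_method ::
  "nat \<Rightarrow> (nat \<Rightarrow> 'a::euclidean_space \<Rightarrow> real) \<Rightarrow> ('a \<Rightarrow> ereal) \<Rightarrow> ('a \<Rightarrow> nat) \<Rightarrow>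
   (nat \<Rightarrow> 'a \<Rightarrow> 'b \<Rightarrow> 'a) \<Rightarrow> (nat \<Rightarrow> real) \<Rightarrow> (nat \<Rightarrow> 'b) \<Rightarrow> (nat \<Rightarrow> 'a) \<Rightarrow> bool" where
  "primal_method m f r sel g \<alpha> \<xi> x \<longleftrightarrow>
     (\<forall>k. if feasible m f (x k)
          then x (Suc k) \<in> prox (\<alpha> k) r (x k - \<alpha> k *\<^sub>R g 0 (x k) (\<xi> k))
          else x (Suc k) = x k - \<alpha> k *\<^sub>R g (sel (x k)) (x k) (\<xi> k))"

(* Index shift: the three functions below, at index k, sum over i < k, so they are
   F_s^(k-1), R^(k-1) and M^(k-1). *)

definition dual_F ::
  "(nat \<Rightarrow> 'a::euclidean_space \<Rightarrow> real) \<Rightarrow> ('a \<Rightarrow> nat) \<Rightarrow> (nat \<Rightarrow> 'a \<Rightarrow> 'b \<Rightarrow> 'a) \<Rightarrow>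
   real \<Rightarrow> (nat \<Rightarrow> real) \<Rightarrow> (nat \<Rightarrow> 'b) \<Rightarrow> (nat \<Rightarrow> 'a) \<Rightarrow> nat \<Rightarrow> nat \<Rightarrow> 'a \<Rightarrow> real" where
  "dual_F f sel g \<mu> lam \<xi> y k s z =
     (\<Sum>i\<in>{i. i < k \<and> sel (y i) = s}.
        lam i * (f (sel (y i)) (y i) + inner (g (sel (y i)) (y i) (\<xi> i)) (z - y i)
                 + \<mu> / 2 * (norm (z - y i))\<^sup>2))"

(* When sel (y i) = 0, the iterate y (Suc i) minimizes an objective containing r, so
   r (y (Suc i)) is finite and real_of_ereal loses nothing. *)
definition dual_R ::
  "('a::euclidean_space \<Rightarrow> ereal) \<Rightarrow> ('a \<Rightarrow> nat) \<Rightarrow> (nat \<Rightarrow> real) \<Rightarrow>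
   (nat \<Rightarrow> 'a) \<Rightarrow> (nat \<Rightarrow> 'a) \<Rightarrow> nat \<Rightarrow> 'a \<Rightarrow> real" where
  "dual_R r sel lam y n k z =
     (\<Sum>i\<in>{i. i < k \<and> sel (y i) = 0}.
        lam i * (real_of_ereal (r (y (Suc i))) + inner (n (Suc i)) (z - y (Suc i))))"

definition dual_M ::
  "nat \<Rightarrow> (nat \<Rightarrow> 'a::euclidean_space \<Rightarrow> real) \<Rightarrow> ('a \<Rightarrow> ereal) \<Rightarrow> ('a \<Rightarrow> nat) \<Rightarrow>
   (nat \<Rightarrow> 'a \<Rightarrow> 'b \<Rightarrow> 'a) \<Rightarrow> real \<Rightarrow> (nat \<Rightarrow> real) \<Rightarrow> (nat \<Rightarrow> 'b) \<Rightarrow>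
   (nat \<Rightarrow> 'a) \<Rightarrow> (nat \<Rightarrow> 'a) \<Rightarrow> nat \<Rightarrow> 'a \<Rightarrow> real" where
  "dual_M m f r sel g \<mu> lam \<xi> y n k z =
     (\<Sum>s=0..m. dual_F f sel g \<mu> lam \<xi> y k s z) + dual_R r sel lam y n k z"

definition dual_U ::
  "nat \<Rightarrow> (nat \<Rightarrow> 'a::euclidean_space \<Rightarrow> real) \<Rightarrow> ('a \<Rightarrow> ereal) \<Rightarrow> ('a \<Rightarrow> nat) \<Rightarrow>
   (nat \<Rightarrow> 'a \<Rightarrow> 'b \<Rightarrow> 'a) \<Rightarrow> real \<Rightarrow> (nat \<Rightarrow> real) \<Rightarrow> (nat \<Rightarrow> 'b) \<Rightarrow>
   (nat \<Rightarrow> 'a) \<Rightarrow> nat \<Rightarrow> 'a \<Rightarrow> ereal" where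
  "dual_U m f r sel g \<mu> lam \<xi> y k z =
     (if feasible m f (y k)
      then ereal (lam k) *
             (ereal (f 0 (y k) + inner (g 0 (y k) (\<xi> k)) (z - y k)
                     + \<mu> / 2 * (norm (z - y k))\<^sup>2) + r z)
      else ereal (lam k *
             (f (sel (y k)) (y k) + inner (g (sel (y k)) (y k) (\<xi> k)) (z - y k)
              + \<mu> / 2 * (norm (z - y k))\<^sup>2)))"

(* n (Suc i) is constrained only when sel (y i) = 0, the only case in which it is used. It is
   fixed by its formula; that it lies in the subdifferential of r at y (Suc i) follows from the
   optimality of y (Suc i) and is not assumed. *)
definition dual_method ::
  "nat \<Rightarrow> (nat \<Rightarrow> 'a::euclidean_space \<Rightarrow> real) \<Rightarrow> ('a \<Rightarrow> ereal) \<Rightarrow> ('a \<Rightarrow> nat) \<Rightarrow>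
   (nat \<Rightarrow> 'a \<Rightarrow> 'b \<Rightarrow> 'a) \<Rightarrow> real \<Rightarrow> (nat \<Rightarrow> real) \<Rightarrow> (nat \<Rightarrow> real) \<Rightarrow> (nat \<Rightarrow> 'b) \<Rightarrow>
   (nat \<Rightarrow> 'a) \<Rightarrow> (nat \<Rightarrow> 'a) \<Rightarrow> bool" where
  "dual_method m f r sel g \<mu> lam \<beta> \<xi> y n \<longleftrightarrow>
     (\<forall>i. sel (y i) = 0 \<longrightarrow>
        n (Suc i) = - (1 / lam i) *\<^sub>R
          (grad (dual_M m f r sel g \<mu> lam \<xi> y n i) (y (Suc i))
           + lam i *\<^sub>R (g 0 (y i) (\<xi> i) + \<mu> *\<^sub>R (y (Suc i) - y i))
           + \<beta> i *\<^sub>R (y (Suc i) - y 0))) \<and>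
     (\<forall>k. y (Suc k) \<in> argmin_set (\<lambda>z.
        ereal (dual_M m f r sel g \<mu> lam \<xi> y n k z)
        + dual_U m f r sel g \<mu> lam \<xi> y k z
        + ereal (\<beta> k / 2 * (norm (z - y 0))\<^sup>2)))"

end

theory Submission
  imports Defs
begin

text \<open>
  All linearizations in the dual model have Hessian a multiple of the identity, and past values of
  \<open>r\<close> enter only through affine functions, so the regularized model is one isotropic quadratic.
  Put \<open>c = \<mu> * (\<Sum>i<k. lam i) + \<beta>bar\<close>. The invariant, proved along each sample path, is that the
  regularized model at step \<open>k\<close> equals \<open>c / 2 * (norm (z - y k))\<^sup>2\<close> up to an additive constant: the
  whole history is remembered only through the current iterate. At \<open>k = 0\<close> the model is empty and
  only the regularizer, centred at \<open>y 0\<close>, is left.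

  Adding the linearization taken at \<open>y k\<close>, with its curvature \<open>\<mu>\<close>, and completing the square moves
  the centre to \<open>w = y k - \<alpha> k *\<^sub>R g\<close> and raises the curvature to \<open>c + \<mu> * lam k\<close>, because the
  stepsize is \<open>lam k\<close> divided by this new curvature (\<open>model_complete_square\<close>). If \<open>y k\<close> is
  infeasible, nothing else is added, so the next dual iterate is \<open>w\<close>, which is the primal
  subgradient step. If \<open>y k\<close> is feasible, the objective is \<open>lam k\<close> times the proximal objective at
  \<open>w\<close>, so the next dual iterate is the proximal step. The vector \<open>n (Suc k)\<close> is by its definition
  minus the gradient, at \<open>y (Suc k)\<close> and divided by \<open>lam k\<close>, of that quadratic; replacing \<open>r\<close> by the
  affine function with slope \<open>n (Suc k)\<close> therefore shifts the centre of the quadratic from \<open>w\<close> to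
  \<open>y (Suc k)\<close>, which restores the invariant (\<open>dual_step\<close>).

  Thus the dual iterates obey the primal recursion. A proximal point is unique, since the proximal
  objective is strictly convex (\<open>prox_unique\<close>), so equal starting points give equal sequences.
\<close>

lemma argmin_set_iff: "p \<in> argmin_set h \<longleftrightarrow> (\<forall>z. h p \<le> h z)"
  by (auto simp: argmin_set_def is_arg_min_def not_less)

lemma argmin_set_rescale:
  assumes "c > 0" and "\<And>z. h z = ereal C + ereal c * h' z"
  shows "argmin_set h = argmin_set h'"
proof -
  have "ereal C + ereal c * a \<le> ereal C + ereal c * b \<longleftrightarrow> a \<le> b" for a b
    using \<open>c > 0\<close> by (cases a; cases b) auto
  then show ?thesis
    by (auto simp: argmin_set_iff assms(2))
qed

text \<open>
  At the midpoint of two minimizers the squared distance to the prox centre drops below the average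
  by a quarter of the squared distance between them (parallelogram law), while \<open>r\<close> is at most its
  average.
\<close>

lemma prox_unique:
  fixes r :: "'a::euclidean_space \<Rightarrow> ereal"
  assumes r: "proper_closed_convex r" and "a > 0"
    and p: "p \<in> prox a r w" and q: "q \<in> prox a r w"
  shows "p = q"
proof -
  define d where "d z = 1 / (2 * a) * (norm (z - w))\<^sup>2" for z
  have minp: "r p + ereal (d p) \<le> r z + ereal (d z)"
    and minq: "r q + ereal (d q) \<le> r z + ereal (d z)" for z
    using p q by (auto simp: prox_def argmin_set_iff d_def)
  obtain z0 where "r z0 \<noteq> \<infinity>"
    using r by (auto simp: proper_closed_convex_def)
  then have fin: "r p \<noteq> \<infinity>" "r q \<noteq> \<infinity>"
    using minp[of z0] minq[of z0] by (cases "r z0"; auto)+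
  then obtain s t where st: "r p = ereal s" "r q = ereal t"
    using r unfolding proper_closed_convex_def by (metis ereal_cases)
  define h where "h = (1/2) *\<^sub>R p + (1/2) *\<^sub>R q"
  have "(1/2) *\<^sub>R (p, s) + (1/2) *\<^sub>R (q, t) \<in> epi r"
    using r st by (intro convexD) (auto simp: proper_closed_convex_def epi_def)
  then have rh: "r h \<le> ereal ((s + t) / 2)"
    by (simp add: epi_def h_def add_divide_distrib)
  then obtain u where u: "r h = ereal u"
    using r unfolding proper_closed_convex_def by (cases "r h") auto
  have "h - w = (1/2) *\<^sub>R ((p - w) + (q - w))"
    by (simp add: h_def algebra_simps flip: scaleR_add_left)
  then have "(norm (h - w))\<^sup>2 = (norm ((p - w) + (q - w)))\<^sup>2 / 4"
    by (simp add: power_divide)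
  moreover have "(norm ((p - w) + (q - w)))\<^sup>2 + (norm (p - q))\<^sup>2
      = 2 * (norm (p - w))\<^sup>2 + 2 * (norm (q - w))\<^sup>2"
    unfolding power2_norm_eq_inner by (simp add: algebra_simps inner_commute)
  ultimately have "(norm (p - q))\<^sup>2
      = 2 * (norm (p - w))\<^sup>2 + 2 * (norm (q - w))\<^sup>2 - 4 * (norm (h - w))\<^sup>2"
    by simp
  then have "1 / (2 * a) * (norm (p - q))\<^sup>2 = 2 * d p + 2 * d q - 4 * d h"
    by (simp add: d_def right_diff_distrib diff_divide_distrib add_divide_distrib)
  moreover have "s + d p \<le> u + d h" "t + d q \<le> u + d h" "u \<le> (s + t) / 2"
    using minp[of h] minq[of h] rh st u by auto
  ultimately have "1 / (2 * a) * (norm (p - q))\<^sup>2 \<le> 0"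
    by argo
  then show ?thesis
    using \<open>a > 0\<close> by (simp add: divide_le_0_iff)
qed

lemma grad_eqI:
  assumes "GDERIV h x :> v"
  shows "grad h x = v"
proof -
  have "v' = v" if "GDERIV h x :> v'" for v'
    using has_derivative_unique[OF that[unfolded gderiv_def] assms[unfolded gderiv_def]]
    by (metis vector_eq_ldot inner_commute)
  with assms show ?thesis
    unfolding grad_def by (rule the_equality)
qed

text \<open>
  The difference arises because \<open>n (Suc k)\<close> is defined by the gradient of the model alone, which is
  the quadratic of the invariant minus the regularizer.
\<close>

lemma grad_diff_quadratics:
  fixes p q x :: "'a::real_inner"
  shows "grad (\<lambda>z. C + c / 2 * (norm (z - p))\<^sup>2 - b / 2 * (norm (z - q))\<^sup>2) x
    = c *\<^sub>R (x - p) - b *\<^sub>R (x - q)"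
proof (rule grad_eqI)
  show "GDERIV (\<lambda>z. C + c / 2 * (norm (z - p))\<^sup>2 - b / 2 * (norm (z - q))\<^sup>2) x
    :> c *\<^sub>R (x - p) - b *\<^sub>R (x - q)"
    unfolding gderiv_def power2_norm_eq_inner
    by (auto intro!: derivative_eq_intros simp: fun_eq_iff inner_commute algebra_simps)
qed

text \<open>
  The centre moves by \<open>lam / c'\<close> along the subgradient, where \<open>c'\<close> is the new curvature: this
  quotient is the primal stepsize.
\<close>

lemma model_complete_square:
  fixes v z p :: "'a::real_inner"
  assumes "c' = c + \<mu> * lam" and "c' > 0"
  shows "c / 2 * (norm (z - p))\<^sup>2 + lam * (a + inner v (z - p) + \<mu> / 2 * (norm (z - p))\<^sup>2)
    = lam * a - lam\<^sup>2 / (2 * c') * (norm v)\<^sup>2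
      + c' / 2 * (norm (z - (p - (lam / c') *\<^sub>R v)))\<^sup>2"
proof -
  have expand: "(norm (d + a *\<^sub>R v))\<^sup>2 = (norm d)\<^sup>2 + 2 * a * inner v d + a\<^sup>2 * (norm v)\<^sup>2"
    for d :: 'a and a
    unfolding power2_norm_eq_inner
    by (simp add: inner_add_left inner_add_right inner_commute[of d v] power2_eq_square
        distrib_left)
  have "z - (p - (lam / c') *\<^sub>R v) = (z - p) + (lam / c') *\<^sub>R v"
    by simp
  then have "(norm (z - (p - (lam / c') *\<^sub>R v)))\<^sup>2
      = (norm (z - p))\<^sup>2 + 2 * (lam / c') * inner v (z - p) + (lam / c')\<^sup>2 * (norm v)\<^sup>2"
    by (simp only: expand)
  then have "c' / 2 * (norm (z - (p - (lam / c') *\<^sub>R v)))\<^sup>2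
      = c' / 2 * (norm (z - p))\<^sup>2 + lam * inner v (z - p) + lam\<^sup>2 / (2 * c') * (norm v)\<^sup>2"
    using \<open>c' > 0\<close> by (simp add: field_simps power2_eq_square)
  then show ?thesis
    by (simp add: assms(1) algebra_simps add_divide_distrib)
qed

text \<open>
  Adding to a quadratic the linear function that cancels its gradient at \<open>p\<close> recentres it at \<open>p\<close>.
\<close>

lemma quadratic_recentre:
  fixes z p w :: "'a::real_inner"
  shows "c / 2 * (norm (z - w))\<^sup>2 - c * inner (p - w) (z - p)
    = c / 2 * (norm (p - w))\<^sup>2 + c / 2 * (norm (z - p))\<^sup>2"
proof -
  have "(norm (z - w))\<^sup>2 = (norm (z - p))\<^sup>2 + (norm (p - w))\<^sup>2 + 2 * inner (p - w) (z - p)"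
    unfolding power2_norm_eq_inner by (simp add: algebra_simps inner_commute)
  then show ?thesis
    by (simp add: distrib_left)
qed

lemma sel_eq_0_iff_feasible:
  assumes "selection_rule m f sel"
  shows "sel p = 0 \<longleftrightarrow> feasible m f p"
  using assms unfolding selection_rule_def by (metis atLeastAtMost_iff not_one_le_zero)

lemma sel_le:
  assumes "selection_rule m f sel"
  shows "sel p \<le> m"
  using assms unfolding selection_rule_def by (metis atLeastAtMost_iff le0)

lemma less_Suc_Collect_split:
  "{i. i < Suc k \<and> Q i} = (if Q k then insert k {i. i < k \<and> Q i} else {i. i < k \<and> Q i})"
  by (auto simp: less_Suc_eq)

lemma dual_M_0: "dual_M m f r sel g \<mu> lam \<xi> y n 0 z = 0"
  by (simp add: dual_M_def dual_F_def dual_R_def)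

lemma dual_M_Suc:
  assumes "sel (y k) \<le> m"
  shows "dual_M m f r sel g \<mu> lam \<xi> y n (Suc k) z = dual_M m f r sel g \<mu> lam \<xi> y n k z
    + lam k * (f (sel (y k)) (y k) + inner (g (sel (y k)) (y k) (\<xi> k)) (z - y k)
               + \<mu> / 2 * (norm (z - y k))\<^sup>2)
    + (if sel (y k) = 0
       then lam k * (real_of_ereal (r (y (Suc k))) + inner (n (Suc k)) (z - y (Suc k)))
       else 0)"
proof -
  define t where "t = lam k * (f (sel (y k)) (y k) + inner (g (sel (y k)) (y k) (\<xi> k)) (z - y k)
               + \<mu> / 2 * (norm (z - y k))\<^sup>2)"
  have "dual_F f sel g \<mu> lam \<xi> y (Suc k) s z
      = dual_F f sel g \<mu> lam \<xi> y k s z + (if sel (y k) = s then t else 0)" for s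
    unfolding dual_F_def t_def by (simp add: less_Suc_Collect_split)
  then have "(\<Sum>s=0..m. dual_F f sel g \<mu> lam \<xi> y (Suc k) s z)
      = (\<Sum>s=0..m. dual_F f sel g \<mu> lam \<xi> y k s z) + t"
    using assms by (simp add: sum.distrib)
  moreover have "dual_R r sel lam y n (Suc k) z = dual_R r sel lam y n k z
    + (if sel (y k) = 0
       then lam k * (real_of_ereal (r (y (Suc k))) + inner (n (Suc k)) (z - y (Suc k)))
       else 0)"
    unfolding dual_R_def by (simp add: less_Suc_Collect_split)
  ultimately show ?thesis
    by (simp add: dual_M_def t_def)
qed

text \<open>
  The model hypothesis is the invariant at \<open>k\<close>, with curvature \<open>c\<close>; the first two conclusions are
  the primal update with stepsize \<open>lam k / c'\<close>, the third is the invariant at \<open>Suc k\<close>. The square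
  is completed with the curvature \<open>c'\<close> after the step, because \<open>c\<close> is zero at the start when there
  is no regularizer.
\<close>

lemma dual_step:
  fixes y n :: "nat \<Rightarrow> 'a::euclidean_space"
  assumes sel: "selection_rule m f sel"
    and dual: "dual_method m f r sel g \<mu> lam (\<lambda>_. b) \<xi> y n"
    and lam: "lam k > 0"
    and c': "c' = c + \<mu> * lam k" "c' > 0"
    and model: "\<And>z. dual_M m f r sel g \<mu> lam \<xi> y n k z + b / 2 * (norm (z - y 0))\<^sup>2
      = C + c / 2 * (norm (z - y k))\<^sup>2"
  shows "feasible m f (y k) \<Longrightarrow>
      y (Suc k) \<in> prox (lam k / c') r (y k - (lam k / c') *\<^sub>R g 0 (y k) (\<xi> k))"
    and "\<not> feasible m f (y k) \<Longrightarrow>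
      y (Suc k) = y k - (lam k / c') *\<^sub>R g (sel (y k)) (y k) (\<xi> k)"
    and "\<exists>C'. \<forall>z. dual_M m f r sel g \<mu> lam \<xi> y n (Suc k) z + b / 2 * (norm (z - y 0))\<^sup>2
      = C' + c' / 2 * (norm (z - y (Suc k)))\<^sup>2"
proof -
  let ?M = "dual_M m f r sel g \<mu> lam \<xi> y n"
  define v where "v = g (sel (y k)) (y k) (\<xi> k)"
  define w where "w = y k - (lam k / c') *\<^sub>R v"
  define l where "l z = f (sel (y k)) (y k) + inner v (z - y k) + \<mu> / 2 * (norm (z - y k))\<^sup>2" for z
  define K where "K = C + lam k * f (sel (y k)) (y k) - (lam k)\<^sup>2 / (2 * c') * (norm v)\<^sup>2"
  have square: "?M k z + lam k * l z + b / 2 * (norm (z - y 0))\<^sup>2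
      = K + c' / 2 * (norm (z - w))\<^sup>2" for z
    using model[of z] model_complete_square[OF c', of z "y k" "f (sel (y k)) (y k)" v]
    by (simp add: l_def w_def K_def)
  have next_M: "?M (Suc k) z = ?M k z + lam k * l z
      + (if sel (y k) = 0
         then lam k * (real_of_ereal (r (y (Suc k))) + inner (n (Suc k)) (z - y (Suc k)))
         else 0)" for z
    unfolding l_def v_def by (rule dual_M_Suc[of sel y k m, OF sel_le[OF sel]])
  have argmin: "y (Suc k) \<in> argmin_set (\<lambda>z. ereal (?M k z)
      + dual_U m f r sel g \<mu> lam \<xi> y k z + ereal (b / 2 * (norm (z - y 0))\<^sup>2))"
    using dual by (simp add: dual_method_def)
  {
    assume feas: "feasible m f (y k)"
    then have sel0: "sel (y k) = 0"
      using sel_eq_0_iff_feasible[OF sel] by simp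
    have objective: "ereal (?M k z) + dual_U m f r sel g \<mu> lam \<xi> y k z
        + ereal (b / 2 * (norm (z - y 0))\<^sup>2)
        = ereal K + ereal (lam k) * (r z + ereal (1 / (2 * (lam k / c')) * (norm (z - w))\<^sup>2))" for z
    proof -
      have U: "dual_U m f r sel g \<mu> lam \<xi> y k z = ereal (lam k) * (ereal (l z) + r z)"
        using feas sel0 by (simp add: dual_U_def l_def v_def)
      have "lam k * (1 / (2 * (lam k / c')) * (norm (z - w))\<^sup>2) = c' / 2 * (norm (z - w))\<^sup>2"
        using lam c'(2) by (simp add: field_simps)
      then show ?thesis
        unfolding U using square[of z] lam by (cases "r z") (simp_all add: distrib_left)
    qed
    have "y (Suc k) \<in> prox (lam k / c') r w"
      using argmin unfolding prox_def argmin_set_rescale[OF lam objective] .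
    then show "y (Suc k) \<in> prox (lam k / c') r (y k - (lam k / c') *\<^sub>R g 0 (y k) (\<xi> k))"
      by (simp add: w_def v_def sel0)
  }
  have infeas: "y (Suc k) = w" if "\<not> feasible m f (y k)"
  proof -
    have objective: "ereal (?M k z) + dual_U m f r sel g \<mu> lam \<xi> y k z
        + ereal (b / 2 * (norm (z - y 0))\<^sup>2)
        = ereal (K + c' / 2 * (norm (z - w))\<^sup>2)" for z
      using that square[of z] by (simp add: dual_U_def l_def v_def)
    have "K + c' / 2 * (norm (y (Suc k) - w))\<^sup>2 \<le> K + c' / 2 * (norm (w - w))\<^sup>2"
      using argmin unfolding argmin_set_iff objective ereal_less_eq by (rule spec)
    then show ?thesis
      using c'(2) by (simp add: mult_le_0_iff)
  qed
  then show "\<not> feasible m f (y k) \<Longrightarrow>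
      y (Suc k) = y k - (lam k / c') *\<^sub>R g (sel (y k)) (y k) (\<xi> k)"
    by (simp add: w_def v_def)
  show "\<exists>C'. \<forall>z. ?M (Suc k) z + b / 2 * (norm (z - y 0))\<^sup>2
      = C' + c' / 2 * (norm (z - y (Suc k)))\<^sup>2"
  proof (cases "feasible m f (y k)")
    case False
    then have "?M (Suc k) z + b / 2 * (norm (z - y 0))\<^sup>2
        = K + c' / 2 * (norm (z - y (Suc k)))\<^sup>2" for z
      using square[of z] next_M[of z] infeas sel_eq_0_iff_feasible[OF sel] by simp
    then show ?thesis
      by blast
  next
    case True
    then have sel0: "sel (y k) = 0"
      using sel_eq_0_iff_feasible[OF sel] by simp
    let ?p = "y (Suc k)"
    have "?M k = (\<lambda>z. C + c / 2 * (norm (z - y k))\<^sup>2 - b / 2 * (norm (z - y 0))\<^sup>2)"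
      using model by (simp add: fun_eq_iff algebra_simps)
    then have gradM: "grad (?M k) ?p = c *\<^sub>R (?p - y k) - b *\<^sub>R (?p - y 0)"
      by (simp only: grad_diff_quadratics)
    \<comment> \<open>The regularizer cancels against its contribution to the gradient of the model, and what is
      left is the gradient of the quadratic centred at \<open>w\<close>.\<close>
    have "n (Suc k) = - (1 / lam k) *\<^sub>R
        (grad (?M k) ?p + lam k *\<^sub>R (v + \<mu> *\<^sub>R (?p - y k)) + b *\<^sub>R (?p - y 0))"
      using dual sel0 by (simp add: dual_method_def v_def)
    also have "grad (?M k) ?p + lam k *\<^sub>R (v + \<mu> *\<^sub>R (?p - y k)) + b *\<^sub>R (?p - y 0)
        = c' *\<^sub>R (?p - y k) + lam k *\<^sub>R v"
      unfolding gradM c'(1) by (simp add: algebra_simps)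
    also have "\<dots> = c' *\<^sub>R (?p - w)"
      using c'(2) by (simp add: w_def algebra_simps)
    finally have "lam k *\<^sub>R n (Suc k) = - (c' *\<^sub>R (?p - w))"
      using lam by simp
    then have slope: "lam k * inner (n (Suc k)) (z - ?p) = - (c' * inner (?p - w) (z - ?p))" for z
      by (metis inner_minus_left inner_scaleR_left)
    have "?M (Suc k) z + b / 2 * (norm (z - y 0))\<^sup>2
        = (K + lam k * real_of_ereal (r ?p) + c' / 2 * (norm (?p - w))\<^sup>2)
          + c' / 2 * (norm (z - ?p))\<^sup>2" for z
      using square[of z] next_M[of z] sel0 slope[of z] quadratic_recentre[of c' z w ?p]
      by (simp add: distrib_left)
    then show ?thesis
      by blast
  qed
qed

text \<open>
  The model has curvature \<open>b\<close> at step zero and gains \<open>\<mu> * lam k\<close> at step \<open>k\<close>, so the curvature after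
  step \<open>k\<close> is exactly the denominator of the primal stepsize.
\<close>

lemma dual_method_imp_primal_method:
  fixes y n :: "nat \<Rightarrow> 'a::euclidean_space"
  assumes sel: "selection_rule m f sel"
    and dual: "dual_method m f r sel g \<mu> lam (\<lambda>_. b) \<xi> y n"
    and lam: "\<And>k. lam k > 0"
    and nonneg: "\<mu> \<ge> 0" "b \<ge> 0" "\<mu> + b > 0"
  shows "primal_method m f r sel g (\<lambda>k. lam k / (\<mu> * (\<Sum>i=0..k. lam i) + b)) \<xi> y"
proof -
  define c where "c k = \<mu> * (\<Sum>i<k. lam i) + b" for k
  have c_Suc: "c (Suc k) = c k + \<mu> * lam k" for k
    by (simp add: c_def algebra_simps)
  have c_pos: "c (Suc k) > 0" for k
  proof (cases "\<mu> = 0")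
    case True
    then show ?thesis
      using nonneg by (simp add: c_def)
  next
    case False
    moreover have "(\<Sum>i<Suc k. lam i) > 0"
      by (rule sum_pos) (auto simp: lam)
    ultimately show ?thesis
      using nonneg unfolding c_def by (simp add: add_pos_nonneg del: sum.lessThan_Suc)
  qed
  have model: "\<exists>C. \<forall>z. dual_M m f r sel g \<mu> lam \<xi> y n k z + b / 2 * (norm (z - y 0))\<^sup>2
      = C + c k / 2 * (norm (z - y k))\<^sup>2" for k
  proof (induction k)
    case 0
    show ?case
      by (rule exI[of _ 0]) (simp add: dual_M_0 c_def)
  next
    case (Suc k)
    then obtain C where "\<And>z. dual_M m f r sel g \<mu> lam \<xi> y n k z + b / 2 * (norm (z - y 0))\<^sup>2
        = C + c k / 2 * (norm (z - y k))\<^sup>2"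
      by blast
    then show ?case
      by (rule dual_step(3)[OF sel dual lam c_Suc c_pos])
  qed
  have c_eq: "\<mu> * (\<Sum>i=0..k. lam i) + b = c (Suc k)" for k
    by (simp add: c_def lessThan_Suc_atMost atLeast0AtMost del: sum.lessThan_Suc)
  show ?thesis
    unfolding primal_method_def c_eq
  proof
    fix k
    obtain C where C: "\<And>z. dual_M m f r sel g \<mu> lam \<xi> y n k z + b / 2 * (norm (z - y 0))\<^sup>2
        = C + c k / 2 * (norm (z - y k))\<^sup>2"
      using model by blast
    show "if feasible m f (y k)
      then y (Suc k) \<in> prox (lam k / c (Suc k)) r (y k - (lam k / c (Suc k)) *\<^sub>R g 0 (y k) (\<xi> k))
      else y (Suc k) = y k - (lam k / c (Suc k)) *\<^sub>R g (sel (y k)) (y k) (\<xi> k)"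
      using dual_step(1,2)[OF sel dual lam c_Suc c_pos C] by simp
  qed
qed

lemma primal_method_unique:
  fixes x y :: "nat \<Rightarrow> 'a::euclidean_space"
  assumes r: "proper_closed_convex r" and \<alpha>: "\<And>k. \<alpha> k > 0"
    and x: "primal_method m f r sel g \<alpha> \<xi> x" and y: "primal_method m f r sel g \<alpha> \<xi> y"
    and "x 0 = y 0"
  shows "x k = y k"
proof (induction k)
  case 0
  show ?case by fact
next
  case (Suc k)
  show ?case
  proof (cases "feasible m f (y k)")
    case True
    let ?w = "y k - \<alpha> k *\<^sub>R g 0 (y k) (\<xi> k)"
    have "x (Suc k) \<in> prox (\<alpha> k) r ?w" "y (Suc k) \<in> prox (\<alpha> k) r ?w"
      using x y True Suc unfolding primal_method_def by metis+
    then show ?thesis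
      by (rule prox_unique[OF r \<alpha>])
  next
    case False
    then show ?thesis
      using x y Suc unfolding primal_method_def by metis
  qed
qed

theorem theorem3p1:
  fixes m :: nat
    and f :: "nat \<Rightarrow> 'a::euclidean_space \<Rightarrow> real"
    and r :: "'a \<Rightarrow> ereal"
    and sel :: "'a \<Rightarrow> nat"
    and g :: "nat \<Rightarrow> 'a \<Rightarrow> 'b \<Rightarrow> 'a"
    and P :: "'w measure" and D :: "'b measure"
    and \<xi> :: "nat \<Rightarrow> 'w \<Rightarrow> 'b"
    and x y n :: "nat \<Rightarrow> 'w \<Rightarrow> 'a"
    and \<alpha> lam \<beta> :: "nat \<Rightarrow> real"
    and \<mu> \<beta>bar :: real
  assumes "\<And>s. s \<le> m \<Longrightarrow> convex_on UNIV (f s)"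
    and "proper_closed_convex r"
    and "selection_rule m f sel"
    and "prob_space P"
    and "iid_samples P D \<xi>"
    and "unbiased_oracle m f D g"
    and "\<And>k. \<alpha> k > 0"
    and "\<And>k. lam k > 0"
    and "\<And>k. \<beta> k \<ge> 0"
    and "\<mu> \<ge> 0"
    and "\<And>\<omega>. \<omega> \<in> space P \<Longrightarrow>
           primal_method m f r sel g \<alpha> (\<lambda>k. \<xi> k \<omega>) (\<lambda>k. x k \<omega>)"
    and "\<And>\<omega>. \<omega> \<in> space P \<Longrightarrow>
           dual_method m f r sel g \<mu> lam \<beta> (\<lambda>k. \<xi> k \<omega>) (\<lambda>k. y k \<omega>) (\<lambda>k. n k \<omega>)"
    and "\<And>\<omega>. \<omega> \<in> space P \<Longrightarrow> x 0 \<omega> = y 0 \<omega>"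
    and "\<And>k. \<beta> k = \<beta>bar"
    and "\<beta>bar \<ge> 0"
    and "\<mu> + \<beta>bar > 0"
    and "\<And>k. \<alpha> k = lam k / (\<mu> * (\<Sum>i=0..k. lam i) + \<beta>bar)"
  shows "\<forall>k. \<forall>\<omega>\<in>space P. x k \<omega> = y k \<omega>"
proof (intro allI ballI)
  fix k \<omega>
  assume \<omega>: "\<omega> \<in> space P"
  have "\<beta> = (\<lambda>_. \<beta>bar)"
    using assms(14) by blast
  with assms(12)[OF \<omega>]
  have "dual_method m f r sel g \<mu> lam (\<lambda>_. \<beta>bar) (\<lambda>k. \<xi> k \<omega>) (\<lambda>k. y k \<omega>) (\<lambda>k. n k \<omega>)"
    by simp
  from dual_method_imp_primal_method[OF assms(3) this assms(8,10,15,16)]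
  have "primal_method m f r sel g \<alpha> (\<lambda>k. \<xi> k \<omega>) (\<lambda>k. y k \<omega>)"
    by (simp flip: assms(17))
  from primal_method_unique[OF assms(2,7) assms(11)[OF \<omega>] this assms(13)[OF \<omega>]]
  show "x k \<omega> = y k \<omega>" .
qed

end
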